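(* Suppose that $\Sigma(A,B,C)$, with $Bu=bu$ and $Cx=\langle x,c\rangle$, is a minimal system on a Hilbert space $\mathcal Z$ with $\langle b,c\rangle\neq0$ and $c\in D(A^* )$, and suppose that the eigenfunctions of the operator $$A_\infty z=Az-\frac{\langle Az,c\rangle}{\langle b,c\rangle}\,b,\qquad D(A_\infty)=D(A),$$ corresponding to the invariant zeros of $\Sigma(A,B,C)$ form a Riesz system. Write the invariant zeros of $\Sigma(A,B,C)$ as $\{\mu_1,\mu_2,\ldots\}$ (repeated according to multiplicity) and let $\{z_1,z_2,\ldots\}$ be the corresponding normalized eigenfunctions of $A_\infty$. Then for any $\varepsilon>0$ there is $N$ such that for all $n>N$ $$\|Az_n-\mu_nz_n\|<\varepsilon,$$ that is, $\mu_n\in\sigma_\varepsilon(A)$.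
   Context: $\mathcal Z$ is a complex Hilbert space. A system $\Sigma(A,B,C)$ consists of the generator $A:D(A)\subset\mathcal Z\to\mathcal Z$ of a $C_0$-semigroup on $\mathcal Z$ and bounded operators $B:\mathbb C\to\mathcal Z$, $Bu=bu$, and $C:\mathcal Z\to\mathbb C$, $Cx=\langle x,c\rangle$, with $b,c\in\mathcal Z$ and $B,C\neq0$. Standing assumption: $\sigma(A)$ is non-empty and consists only of isolated eigenvalues with finite algebraic multiplicity. An invariant zero is a $\lambda\in\mathbb C$ for which there are a non-zero $x\in D(A)$ and a scalar $u$ with $(\lambda I-A)x-Bu=0$ and $Cx=0$. The system is minimal if no invariant zero belongs to $\sigma(A)$. When $\langle b,c\rangle\ne0$ and the system is minimal, it is known that, with $c^\perp=\{x\in\mathcal Z:\langle x,c\rangle=0\}$, $A_\infty(c^\perp\cap D(A))\subset c^\perp$, that the invariant zeros $\mu_n$ of $\Sigma(A,B,C)$ are eigenvalues of $A_\infty|_{c^\perp}$, and that the corresponding eigenfunctions are $(\mu_nI-A)^{-1}b$. A sequence $\{\phi_n\}$ in $\mathcal Z$ is a Riesz system if there is an isomorphism $S\in L(\mathcal Z)$ such that $\{S\phi_n\}$ is an orthonormal system in $\mathcal Z$. For $\varepsilon>0$ the $\varepsilon$-pseudospectrum of $A$ is $\sigma_\varepsilon(A)=\{s\in\mathbb C:\ \|sz-Az\|<\varepsilon\text{ for some }z\in D(A),\ \|z\|=1\}$. *)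

theory Defs
  imports "HOL-Analysis.Analysis" "HOL-Library.Extended_Nat"
begin

text \<open>The inner product is linear in its first argument, so that \<open>x \<mapsto> cinner x c\<close> is linear.\<close>

class complex_hilbert_space = banach +
  fixes scaleC :: "complex \<Rightarrow> 'a \<Rightarrow> 'a" (infixr "*\<^sub>C" 75)
    and cinner :: "'a \<Rightarrow> 'a \<Rightarrow> complex"
  assumes scaleC_add_right: "a *\<^sub>C (x + y) = a *\<^sub>C x + a *\<^sub>C y"
    and scaleC_add_left: "(a + a') *\<^sub>C x = a *\<^sub>C x + a' *\<^sub>C x"
    and scaleC_scaleC: "a *\<^sub>C (a' *\<^sub>C x) = (a * a') *\<^sub>C x"
    and scaleC_one: "1 *\<^sub>C x = x"
    and scaleR_scaleC: "r *\<^sub>R x = complex_of_real r *\<^sub>C x"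
    and cinner_add_left: "cinner (x + y) z = cinner x z + cinner y z"
    and cinner_scaleC_left: "cinner (a *\<^sub>C x) y = a * cinner x y"
    and cinner_commute: "cinner x y = cnj (cinner y x)"
    and cinner_self: "cinner x x = complex_of_real ((norm x)\<^sup>2)"

global_interpretation complex_vector:
  vector_space "scaleC :: complex \<Rightarrow> 'a \<Rightarrow> 'a::complex_hilbert_space"
  by unfold_locales
    (simp_all add: scaleC_add_right scaleC_add_left scaleC_scaleC scaleC_one)

definition bounded_clinear :: "('a::complex_hilbert_space \<Rightarrow> 'a) \<Rightarrow> bool" where
  "bounded_clinear f \<longleftrightarrow> bounded_linear f \<and> (\<forall>a x. f (a *\<^sub>C x) = a *\<^sub>C f x)"

definition orth_compl :: "'a::complex_hilbert_space \<Rightarrow> 'a set" where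
  "orth_compl c = {x. cinner x c = 0}"

text \<open>An operator is given by its domain \<open>D\<close> and a function \<open>A\<close>, whose values outside \<open>D\<close> are
  irrelevant. A semigroup is indexed by \<open>real\<close>; only times \<open>t \<ge> 0\<close> matter.\<close>

definition c0_semigroup :: "(real \<Rightarrow> 'a \<Rightarrow> 'a::complex_hilbert_space) \<Rightarrow> bool" where
  "c0_semigroup T \<longleftrightarrow>
     (\<forall>t\<ge>0. bounded_clinear (T t)) \<and>
     (\<forall>x. T 0 x = x) \<and>
     (\<forall>s\<ge>0. \<forall>t\<ge>0. \<forall>x. T (s + t) x = T s (T t x)) \<and>
     (\<forall>x. ((\<lambda>t. T t x) \<longlongrightarrow> x) (at_right 0))"

definition generates_c0_semigroup :: "'a::complex_hilbert_space set \<Rightarrow> ('a \<Rightarrow> 'a) \<Rightarrow> bool" where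
  "generates_c0_semigroup D A \<longleftrightarrow> (\<exists>T. c0_semigroup T \<and>
     D = {x. \<exists>y. ((\<lambda>t. (T t x - x) /\<^sub>R t) \<longlongrightarrow> y) (at_right 0)} \<and>
     (\<forall>x\<in>D. ((\<lambda>t. (T t x - x) /\<^sub>R t) \<longlongrightarrow> A x) (at_right 0)))"

definition resolvent_set :: "'a::complex_hilbert_space set \<Rightarrow> ('a \<Rightarrow> 'a) \<Rightarrow> complex set" where
  "resolvent_set D A = {s. \<exists>R. bounded_clinear R \<and>
     (\<forall>y. R y \<in> D \<and> s *\<^sub>C R y - A (R y) = y) \<and>
     (\<forall>x\<in>D. R (s *\<^sub>C x - A x) = x)}"

definition spectrum :: "'a::complex_hilbert_space set \<Rightarrow> ('a \<Rightarrow> 'a) \<Rightarrow> complex set" where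
  "spectrum D A = - resolvent_set D A"

definition pseudospectrum ::
    "'a::complex_hilbert_space set \<Rightarrow> ('a \<Rightarrow> 'a) \<Rightarrow> real \<Rightarrow> complex set" where
  "pseudospectrum D A \<epsilon> = {s. \<exists>z\<in>D. norm z = 1 \<and> norm (s *\<^sub>C z - A z) < \<epsilon>}"

definition eigenvector ::
    "'a::complex_hilbert_space set \<Rightarrow> ('a \<Rightarrow> 'a) \<Rightarrow> complex \<Rightarrow> 'a \<Rightarrow> bool" where
  "eigenvector D A s x \<longleftrightarrow> x \<in> D \<and> x \<noteq> 0 \<and> A x = s *\<^sub>C x"

definition eigenvalue :: "'a::complex_hilbert_space set \<Rightarrow> ('a \<Rightarrow> 'a) \<Rightarrow> complex \<Rightarrow> bool" where
  "eigenvalue D A s \<longleftrightarrow> (\<exists>x. eigenvector D A s x)"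

text \<open>The kernel of \<open>(s I - A)\<^sup>k\<close> on its natural domain \<open>D(A\<^sup>k)\<close>.\<close>

primrec ker_power ::
    "'a::complex_hilbert_space set \<Rightarrow> ('a \<Rightarrow> 'a) \<Rightarrow> complex \<Rightarrow> nat \<Rightarrow> 'a set" where
  "ker_power D A s 0 = {0}"
| "ker_power D A s (Suc k) = {x \<in> D. s *\<^sub>C x - A x \<in> ker_power D A s k}"

definition ecard :: "'b set \<Rightarrow> enat" where
  "ecard X = (if finite X then enat (card X) else \<infinity>)"

text \<open>Complex dimension of a subspace, with value \<open>\<infinity>\<close> if it is not finite.\<close>

definition ecdim :: "'a::complex_hilbert_space set \<Rightarrow> enat" where
  "ecdim V = (SUP F \<in> {F. F \<subseteq> V \<and> complex_vector.independent F}. ecard F)"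

definition algebraic_multiplicity ::
    "'a::complex_hilbert_space set \<Rightarrow> ('a \<Rightarrow> 'a) \<Rightarrow> complex \<Rightarrow> enat" where
  "algebraic_multiplicity D A s = ecdim (\<Union>k. ker_power D A s k)"

definition adjoint_domain :: "'a::complex_hilbert_space set \<Rightarrow> ('a \<Rightarrow> 'a) \<Rightarrow> 'a set" where
  "adjoint_domain D A = {y. \<exists>w. \<forall>x\<in>D. cinner (A x) y = cinner x w}"

text \<open>The system with generator \<open>A\<close>, \<open>B u = u b\<close> and \<open>C x = \<langle>x, c\<rangle>\<close>; \<open>B \<noteq> 0\<close> and \<open>C \<noteq> 0\<close> mean
  \<open>b \<noteq> 0\<close> and \<open>c \<noteq> 0\<close>.\<close>

definition siso_system ::
    "'a::complex_hilbert_space set \<Rightarrow> ('a \<Rightarrow> 'a) \<Rightarrow> 'a \<Rightarrow> 'a \<Rightarrow> bool" where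
  "siso_system D A b c \<longleftrightarrow>
     generates_c0_semigroup D A \<and> b \<noteq> 0 \<and> c \<noteq> 0 \<and>
     spectrum D A \<noteq> {} \<and>
     (\<forall>s\<in>spectrum D A. s isolated_in spectrum D A \<and> eigenvalue D A s \<and>
        algebraic_multiplicity D A s < \<infinity>)"

definition invariant_zeros ::
    "'a::complex_hilbert_space set \<Rightarrow> ('a \<Rightarrow> 'a) \<Rightarrow> 'a \<Rightarrow> 'a \<Rightarrow> complex set" where
  "invariant_zeros D A b c =
     {s. \<exists>x\<in>D. \<exists>u::complex. x \<noteq> 0 \<and> (s *\<^sub>C x - A x) - u *\<^sub>C b = 0 \<and> cinner x c = 0}"

definition minimal_system ::
    "'a::complex_hilbert_space set \<Rightarrow> ('a \<Rightarrow> 'a) \<Rightarrow> 'a \<Rightarrow> 'a \<Rightarrow> bool" where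
  "minimal_system D A b c \<longleftrightarrow> invariant_zeros D A b c \<inter> spectrum D A = {}"

definition A_inf :: "('a \<Rightarrow> 'a) \<Rightarrow> 'a \<Rightarrow> 'a \<Rightarrow> 'a \<Rightarrow> 'a::complex_hilbert_space" where
  "A_inf A b c z = A z - (cinner (A z) c / cinner b c) *\<^sub>C b"

text \<open>The multiplicity of an invariant zero is its algebraic multiplicity as an eigenvalue of the
  restriction of \<open>A_inf\<close> to the orthogonal complement of \<open>c\<close>. The unrestricted operator has range
  in that complement, hence the additional eigenvalue \<open>0\<close>, which would be counted wrongly.\<close>

definition zero_multiplicity ::
    "'a::complex_hilbert_space set \<Rightarrow> ('a \<Rightarrow> 'a) \<Rightarrow> 'a \<Rightarrow> 'a \<Rightarrow> complex \<Rightarrow> enat" where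
  "zero_multiplicity D A b c s =
     algebraic_multiplicity (orth_compl c \<inter> D) (A_inf A b c) s"

text \<open>The family \<open>(\<mu> n)\<close>, \<open>n \<in> J\<close>, lists all invariant zeros, repeated according to multiplicity.
  There may be finitely or infinitely many of them, so \<open>J\<close> is an initial segment of the positive
  integers.\<close>

definition lists_invariant_zeros ::
    "'a::complex_hilbert_space set \<Rightarrow> ('a \<Rightarrow> 'a) \<Rightarrow> 'a \<Rightarrow> 'a \<Rightarrow> nat set \<Rightarrow> (nat \<Rightarrow> complex) \<Rightarrow> bool" where
  "lists_invariant_zeros D A b c J \<mu> \<longleftrightarrow>
     (J = {1..} \<or> (\<exists>k. J = {1..k})) \<and>
     \<mu> ` J = invariant_zeros D A b c \<and>
     (\<forall>s\<in>invariant_zeros D A b c. ecard {n \<in> J. \<mu> n = s} = zero_multiplicity D A b c s)"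

text \<open>The index set is arbitrary here; below, the family is indexed by the set of invariant zeros,
  so that repetitions in a listing do not repeat members of the Riesz system (which would
  contradict orthonormality).\<close>

definition riesz_system :: "'i set \<Rightarrow> ('i \<Rightarrow> 'a::complex_hilbert_space) \<Rightarrow> bool" where
  "riesz_system I \<phi> \<longleftrightarrow> (\<exists>S. bounded_clinear S \<and> bij S \<and> bounded_clinear (inv S) \<and>
     (\<forall>i\<in>I. \<forall>j\<in>I. cinner (S (\<phi> i)) (S (\<phi> j)) = (if i = j then 1 else 0)))"

end

theory Submission
  imports Defs
begin

text \<open>If \<open>A_inf z = \<mu> z\<close>, then \<open>A z - \<mu> z = (\<langle>z, A* c\<rangle> / \<langle>b, c\<rangle>) b\<close>. Let \<open>R\<close> be the
  resolvent of \<open>A\<close> at \<open>\<mu>\<close>, which exists by minimality. Then \<open>z\<close> is a multiple of \<open>R b\<close>, hence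
  of \<open>\<phi> \<mu>\<close>, and Bessel's inequality for the Riesz system leaves only finitely many zeros \<open>\<mu>\<close> at
  which \<open>\<langle>\<phi> \<mu>, A* c\<rangle>\<close> is not small. It remains to see that no zero is listed infinitely often.
  If \<open>m\<close> is minimal with \<open>\<langle>R^(m+1) b, c\<rangle> \<noteq> 0\<close>, the root subspace of \<open>\<mu>\<close> is spanned by \<open>R b, \<dots>, R^m b\<close>.
  If there were no such \<open>m\<close>, the transfer function would vanish near \<open>\<mu>\<close> and a whole disc would
  consist of invariant zeros; but a list has only countably many members.\<close>

section \<open>Inner products: Cauchy-Schwarz and Bessel inequalities\<close>

lemma cinner_scaleC_right: "cinner x (a *\<^sub>C y) = cnj a * cinner x y"
  unfolding cinner_commute[of x] by (simp add: cinner_scaleC_left)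

lemma cinner_add_right: "cinner x (y + z) = cinner x y + cinner x z"
  unfolding cinner_commute[of x] by (simp add: cinner_add_left)

lemma cinner_zero_left [simp]: "cinner 0 x = 0"
  using cinner_add_left[of 0 0 x] by simp

lemma cinner_zero_right [simp]: "cinner x 0 = 0"
  using cinner_add_right[of x 0 0] by simp

lemma cinner_diff_left: "cinner (x - y) z = cinner x z - cinner y z"
  using cinner_add_left[of "x - y" y z] by simp

lemma cinner_diff_right: "cinner x (y - z) = cinner x y - cinner x z"
  using cinner_add_right[of x "y - z" z] by simp

lemma cinner_sum_left: "cinner (sum f F) z = (\<Sum>i\<in>F. cinner (f i) z)"
  by (induction F rule: infinite_finite_induct) (auto simp: cinner_add_left)

lemma cinner_sum_right: "cinner z (sum f F) = (\<Sum>i\<in>F. cinner z (f i))"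
  by (induction F rule: infinite_finite_induct) (auto simp: cinner_add_right)

text \<open>The class prescribes the norm for real scalars only; for complex ones it has to come
  from \<open>cinner_self\<close>.\<close>

lemma norm_scaleC: "norm (a *\<^sub>C x) = cmod a * norm (x::'a::complex_hilbert_space)"
proof -
  have "complex_of_real ((norm (a *\<^sub>C x))\<^sup>2) = a * cnj a * complex_of_real ((norm x)\<^sup>2)"
    unfolding cinner_self[symmetric] by (simp add: cinner_scaleC_left cinner_scaleC_right)
  also have "\<dots> = complex_of_real ((cmod a * norm x)\<^sup>2)"
    by (simp add: complex_norm_square[symmetric] power_mult_distrib)
  finally have "(norm (a *\<^sub>C x))\<^sup>2 = (cmod a * norm x)\<^sup>2"
    unfolding of_real_eq_iff .
  then show ?thesis
    by simp
qed

lemma norm_cinner_le: "cmod (cinner x y) \<le> norm x * norm (y::'a::complex_hilbert_space)"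
proof (cases "y = 0")
  case False
  define p where "p = cinner x y"
  define q where "q = (norm y)\<^sup>2"
  have q: "q > 0"
    using False by (simp add: q_def)
  \<comment> \<open>\<open>v\<close> is \<open>q\<close> times the component of \<open>x\<close>
    orthogonal to \<open>y\<close>; the factor \<open>q\<close> avoids a division.\<close>
  define v where "v = complex_of_real q *\<^sub>C x - p *\<^sub>C y"
  have yx: "cinner y x = cnj p"
    unfolding p_def by (rule cinner_commute)
  have "complex_of_real ((norm v)\<^sup>2) = cinner v v"
    by (rule cinner_self[symmetric])
  also have "\<dots> = complex_of_real q * (complex_of_real q * cinner x x - p * cnj p)"
    unfolding v_def cinner_diff_left cinner_diff_right cinner_scaleC_left cinner_scaleC_right yx
      p_def[symmetric] using cinner_self[of y]
    by (simp add: q_def algebra_simps)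
  also have "\<dots> = complex_of_real (q * (q * (norm x)\<^sup>2 - (cmod p)\<^sup>2))"
    by (simp add: cinner_self complex_norm_square[symmetric])
  finally have "(norm v)\<^sup>2 = q * (q * (norm x)\<^sup>2 - (cmod p)\<^sup>2)"
    unfolding of_real_eq_iff .
  then have "0 \<le> q * (q * (norm x)\<^sup>2 - (cmod p)\<^sup>2)"
    by (metis zero_le_power2)
  then have "(cmod p)\<^sup>2 \<le> (norm x * norm y)\<^sup>2"
    using q by (simp add: zero_le_mult_iff q_def power_mult_distrib mult.commute)
  then show ?thesis
    unfolding p_def by (rule power2_le_imp_le) simp
qed simp

lemma bounded_linear_cinner_left: "bounded_linear (\<lambda>x::'a::complex_hilbert_space. cinner x c)"
  by (rule bounded_linear_intro[where K = "norm c"])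
    (simp_all add: cinner_add_left scaleR_scaleC cinner_scaleC_left norm_cinner_le scaleR_conv_of_real)

text \<open>Bessel's inequality for the functional \<open>f\<close>: test \<open>f\<close> on the combination of the \<open>e i\<close> with
  coefficients \<open>cnj (f (e i))\<close>.\<close>

lemma sum_functional_orthonormal_le:
  fixes e :: "'i \<Rightarrow> 'a::complex_hilbert_space"
  assumes F: "finite F"
    and on: "\<And>i j. i \<in> F \<Longrightarrow> j \<in> F \<Longrightarrow> cinner (e i) (e j) = (if i = j then 1 else 0)"
    and add: "\<And>x y. f (x + y) = f x + f y"
    and scale: "\<And>a x. f (a *\<^sub>C x) = a * f x"
    and bd: "\<And>x. cmod (f x) \<le> K * norm x"
  shows "(\<Sum>i\<in>F. (cmod (f (e i)))\<^sup>2) \<le> K\<^sup>2"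
proof -
  define x where "x = (\<Sum>i\<in>F. cnj (f (e i)) *\<^sub>C e i)"
  define T where "T = (\<Sum>i\<in>F. (cmod (f (e i)))\<^sup>2)"
  have f0: "f 0 = 0"
    using add[of 0 0] by simp
  have fsum: "f (sum g G) = (\<Sum>i\<in>G. f (g i))" for g :: "'i \<Rightarrow> 'a" and G
    by (induction G rule: infinite_finite_induct) (auto simp: add f0)
  have fx: "f x = complex_of_real T"
    by (simp add: x_def T_def fsum scale complex_norm_square mult.commute del: of_real_power)
  have "cinner x x = (\<Sum>i\<in>F. \<Sum>j\<in>F. cnj (f (e i)) * f (e j) * cinner (e i) (e j))"
    unfolding x_def
    by (subst sum.swap) (simp add: cinner_sum_left cinner_sum_right cinner_scaleC_left
        cinner_scaleC_right mult_ac sum_distrib_left)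
  also have "\<dots> = (\<Sum>i\<in>F. \<Sum>j\<in>F. if i = j then cnj (f (e i)) * f (e j) else 0)"
    by (intro sum.cong refl) (simp add: on)
  also have "\<dots> = complex_of_real T"
    using F by (simp add: T_def complex_norm_square mult.commute del: of_real_power)
  finally have "(norm x)\<^sup>2 = T"
    unfolding cinner_self of_real_eq_iff .
  moreover have "\<bar>T\<bar> \<le> K * norm x"
    using bd[of x] unfolding fx norm_of_real .
  ultimately have T: "(norm x)\<^sup>2 \<le> K * norm x"
    by simp
  \<comment> \<open>Cancelling \<open>norm x\<close> is possible only if it is nonzero; the absolute
    value makes the bound true for \<open>norm x = 0\<close> as well.\<close>
  have "norm x \<le> \<bar>K\<bar>"
  proof (cases "norm x = 0")
    case False
    then have "norm x \<le> K"
      using T by (simp add: power2_eq_square)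
    then show ?thesis by simp
  qed simp
  then have "(norm x)\<^sup>2 \<le> K\<^sup>2"
    by (metis abs_norm_cancel abs_le_square_iff)
  then show ?thesis
    using \<open>(norm x)\<^sup>2 = T\<close> by (simp add: T_def)
qed

section \<open>Riesz systems\<close>

text \<open>\<open>S\<close> sends the members to unit vectors, so the bound of \<open>S\<close>
  keeps their norms away from zero. Normalizing a member then costs at most the factor
  \<open>L\<close>.\<close>

lemma riesz_system_norm_bound:
  assumes "riesz_system I \<phi>"
  obtains L where "L > 0" "\<And>i. i \<in> I \<Longrightarrow> 1 \<le> L * norm (\<phi> i)"
proof -
  obtain S where S: "bounded_clinear S"
    and on: "\<forall>i\<in>I. \<forall>j\<in>I. cinner (S (\<phi> i)) (S (\<phi> j)) = (if i = j then 1 else 0)"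
    using assms unfolding riesz_system_def by blast
  obtain L where L: "L > 0" "\<And>x. norm (S x) \<le> norm x * L"
    using S bounded_linear.pos_bounded unfolding bounded_clinear_def by blast
  have "1 \<le> L * norm (\<phi> i)" if "i \<in> I" for i
  proof -
    have "complex_of_real ((norm (S (\<phi> i)))\<^sup>2) = complex_of_real 1"
      using on that cinner_self[of "S (\<phi> i)"] by simp
    then have "norm (S (\<phi> i)) = 1"
      unfolding of_real_eq_iff by (simp add: power2_eq_1_iff) (smt (verit) norm_ge_zero)
    then show ?thesis
      using L(2)[of "\<phi> i"] by (simp add: mult.commute)
  qed
  with L(1) show thesis
    by (rule that)
qed

text \<open>Pulled back along \<open>S\<close>, the coefficients are values of one bounded
  functional on an orthonormal family, and each large one uses up at least
  \<open>\<delta>\<^sup>2\<close> of the Bessel bound.\<close>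

lemma riesz_system_finite_large_coefficients:
  assumes "riesz_system I \<phi>" and "\<delta> > 0"
  shows "finite {i \<in> I. cmod (cinner (\<phi> i) w) \<ge> \<delta>}"
proof -
  obtain S where S: "bounded_clinear (inv S)" "bij S"
    and on: "\<forall>i\<in>I. \<forall>j\<in>I. cinner (S (\<phi> i)) (S (\<phi> j)) = (if i = j then 1 else 0)"
    using assms unfolding riesz_system_def by blast
  obtain L where L: "L > 0" "\<And>x. norm (inv S x) \<le> norm x * L"
    using S bounded_linear.pos_bounded unfolding bounded_clinear_def by blast
  define f where "f = (\<lambda>x. cinner (inv S x) w)"
  define K where "K = L * norm w"
  have inv: "inv S (S x) = x" for x
    using S(2) by (simp add: bij_def)
  have bd: "cmod (f x) \<le> K * norm x" for x
  proof -
    have "cmod (f x) \<le> norm (inv S x) * norm w"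
      unfolding f_def by (rule norm_cinner_le)
    also have "\<dots> \<le> norm x * L * norm w"
      by (intro mult_right_mono L(2)) simp
    finally show ?thesis
      by (simp add: K_def mult_ac)
  qed
  \<comment> \<open>Bessel's inequality is available for finite families, so finite subsets are
    counted, with one bound for all of them.\<close>
  have "finite {i \<in> I. cmod (cinner (\<phi> i) w) \<ge> \<delta>} \<and>
      card {i \<in> I. cmod (cinner (\<phi> i) w) \<ge> \<delta>} \<le> nat \<lceil>K\<^sup>2 / \<delta>\<^sup>2\<rceil>"
  proof (rule finite_if_finite_subsets_card_bdd)
    fix F assume F: "F \<subseteq> {i \<in> I. cmod (cinner (\<phi> i) w) \<ge> \<delta>}" "finite F"
    have "real (card F) * \<delta>\<^sup>2 = (\<Sum>i\<in>F. \<delta>\<^sup>2)"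
      by simp
    also have "\<dots> \<le> (\<Sum>i\<in>F. (cmod (f (S (\<phi> i))))\<^sup>2)"
      using F(1) assms(2) by (intro sum_mono power_mono) (auto simp: f_def inv)
    also have "\<dots> \<le> K\<^sup>2"
    proof (rule sum_functional_orthonormal_le[OF F(2)])
      show "cinner (S (\<phi> i)) (S (\<phi> j)) = (if i = j then 1 else 0)" if "i \<in> F" "j \<in> F" for i j
        using that on F(1) by blast
      show "f (x + y) = f x + f y" for x y
        using S(1) by (simp add: f_def bounded_clinear_def bounded_linear.linear linear_add
            cinner_add_left)
      show "f (a *\<^sub>C x) = a * f x" for a x
        using S(1) by (simp add: f_def bounded_clinear_def cinner_scaleC_left)
    qed (rule bd)
    finally have "real (card F) \<le> K\<^sup>2 / \<delta>\<^sup>2"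
      using assms(2) by (simp add: field_simps)
    then show "card F \<le> nat \<lceil>K\<^sup>2 / \<delta>\<^sup>2\<rceil>"
      by linarith
  qed
  then show ?thesis ..
qed

section \<open>Finite multiplicity of the invariant zeros\<close>

lemma ecdim_finite_if_subset_span:
  assumes "finite V" and "U \<subseteq> complex_vector.span V"
  shows "ecdim U < \<infinity>"
proof -
  have "ecdim U \<le> enat (card V)"
    unfolding ecdim_def
  proof (rule SUP_least)
    fix F assume "F \<in> {F. F \<subseteq> U \<and> complex_vector.independent F}"
    then have "finite F \<and> card F \<le> card V"
      using complex_vector.independent_span_bound[OF assms(1), of F] assms(2) by blast
    then show "ecard F \<le> enat (card V)"
      by (simp add: ecard_def)
  qed
  then show ?thesis
    using enat_ord_simps(4) order.strict_trans1 by blast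
qed

text \<open>Each step up the kernel chain applies \<open>R\<close> and adds a multiple of \<open>R b\<close>; membership in the
  orthogonal complement of \<open>c\<close> then rules out the component along the last power.\<close>

lemma algebraic_multiplicity_A_inf_finite:
  assumes R: "bounded_clinear R" "\<forall>x\<in>D. R (s *\<^sub>C x - A x) = x"
    and ex: "\<exists>k. cinner ((R ^^ Suc k) b) c \<noteq> 0"
  shows "algebraic_multiplicity (orth_compl c \<inter> D) (A_inf A b c) s < \<infinity>"
proof -
  define g where "g = (\<lambda>k. (R ^^ Suc k) b)"
  define m where "m = (LEAST k. cinner (g k) c \<noteq> 0)"
  have m: "cinner (g m) c \<noteq> 0"
    using ex unfolding m_def g_def by (rule LeastI_ex)
  have less: "cinner (g k) c = 0" if "k < m" for k
    using that not_less_Least unfolding m_def by blast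
  define V where "V = g ` {..<m}"
  have lin: "R (x + y) = R x + R y" "R (a *\<^sub>C x) = a *\<^sub>C R x" "R (x - y) = R x - R y" "R 0 = 0"
    for x y a
    using R(1) by (simp_all add: bounded_clinear_def bounded_linear.linear linear_add linear_diff
        linear_0)
  have orth: "cinner v c = 0" if "v \<in> complex_vector.span V" for v
    using that
    by (induction rule: complex_vector.span_induct_alt)
      (auto simp: V_def less cinner_add_left cinner_scaleC_left)
  \<comment> \<open>\<open>R\<close> shifts the \<open>g k\<close> by one index, so it may lead from
    \<open>V\<close> to \<open>g m\<close>, the first vector not orthogonal to
    \<open>c\<close>.\<close>
  define W where "W = complex_vector.span (insert (g m) V)"
  have gW: "g k \<in> W" if "k \<le> m" for k
    unfolding W_def V_def using that by (intro complex_vector.span_base) (auto simp: le_less)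
  have RW: "R v \<in> W" if "v \<in> complex_vector.span V" for v
    using that
  proof (induction rule: complex_vector.span_induct_alt)
    case base
    then show ?case by (simp add: lin W_def complex_vector.span_zero)
  next
    case (step a x y)
    then obtain k where k: "k < m" "x = g k"
      by (auto simp: V_def)
    then have "R x = g (Suc k)"
      by (simp add: g_def)
    then have "R x \<in> W"
      using gW k by simp
    then show ?case
      using step.IH unfolding W_def lin
      by (intro complex_vector.span_add complex_vector.span_scale)
  qed
  have "ker_power (orth_compl c \<inter> D) (A_inf A b c) s k \<subseteq> complex_vector.span V" for k
  proof (induction k)
    case 0
    show ?case by (simp add: complex_vector.span_zero)
  next
    case (Suc k)
    show ?case
    proof
      fix x assume x: "x \<in> ker_power (orth_compl c \<inter> D) (A_inf A b c) s (Suc k)"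
      then have xD: "x \<in> D" and xc: "cinner x c = 0"
        by (auto simp: orth_compl_def)
      define \<beta> where "\<beta> = cinner (A x) c / cinner b c"
      define y where "y = s *\<^sub>C x - A_inf A b c x"
      have y: "y \<in> complex_vector.span V"
        using x Suc.IH by (auto simp: y_def)
      have "s *\<^sub>C x - A x = y - \<beta> *\<^sub>C b"
        by (simp add: y_def \<beta>_def A_inf_def)
      then have "x = R y - \<beta> *\<^sub>C g 0"
        using bspec[OF R(2) xD] by (simp add: lin g_def)
      then have "x \<in> W"
        using RW[OF y] gW[of 0] unfolding W_def
        by (simp add: complex_vector.span_diff complex_vector.span_scale)
      then obtain a where a: "x - a *\<^sub>C g m \<in> complex_vector.span V"
        unfolding W_def complex_vector.span_breakdown_eq by blast
      then have "a = 0"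
        using orth[OF a] xc m by (simp add: cinner_diff_left cinner_scaleC_left)
      then show "x \<in> complex_vector.span V"
        using a by simp
    qed
  qed
  then have "(\<Union>k. ker_power (orth_compl c \<inter> D) (A_inf A b c) s k) \<subseteq> complex_vector.span V"
    by blast
  then show ?thesis
    unfolding algebraic_multiplicity_def
    by (intro ecdim_finite_if_subset_span[of V]) (simp_all add: V_def)
qed

text \<open>Near \<open>s\<close> the resolvent equation for \<open>b\<close> is solved by a contraction \<open>x \<mapsto> R b - h R x\<close>, which
  preserves the closed subspace of vectors whose whole \<open>R\<close>-orbit is orthogonal to \<open>c\<close>.\<close>

lemma ball_subset_invariant_zeros:
  assumes R: "bounded_clinear R" "\<And>y. R y \<in> D \<and> s *\<^sub>C R y - A (R y) = y"
    and b: "b \<noteq> 0"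
    and zero: "\<And>k. cinner ((R ^^ Suc k) b) c = 0"
  obtains r where "r > 0" "ball s r \<subseteq> invariant_zeros D A b c"
proof -
  have lin: "R (x + y) = R x + R y" "R (a *\<^sub>C x) = a *\<^sub>C R x" "R (x - y) = R x - R y"
    for x y a
    using R(1) by (simp_all add: bounded_clinear_def bounded_linear.linear linear_add linear_diff)
  have pow: "(R ^^ k) (x - a *\<^sub>C y) = (R ^^ k) x - a *\<^sub>C (R ^^ k) y" for k x a y
    by (induction k) (simp_all add: lin)
  obtain L where L: "L > 0" "\<And>x. norm (R x) \<le> norm x * L"
    using R bounded_linear.pos_bounded unfolding bounded_clinear_def by blast
  \<comment> \<open>The exponent \<open>k = 0\<close> is included, so members of \<open>M\<close>
    are themselves orthogonal to \<open>c\<close>. The hypothesis starts at exponent 1 and thus puts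
    \<open>R b\<close>, not \<open>b\<close>, into \<open>M\<close>.\<close>
  define M where "M = {x. \<forall>k. cinner ((R ^^ k) x) c = 0}"
  have cont: "continuous_on UNIV (\<lambda>x. cinner ((R ^^ k) x) c)" for k
  proof -
    have "bounded_linear (R ^^ k)"
    proof (induction k)
      case 0
      then show ?case by (simp add: id_def)
    next
      case (Suc k)
      then show ?case
        using R(1) unfolding bounded_clinear_def
        by (auto simp: comp_def intro: bounded_linear_compose)
    qed
    then show ?thesis
      using bounded_linear_compose[OF bounded_linear_cinner_left]
      by (intro linear_continuous_on)
  qed
  have "closed M"
    unfolding M_def by (intro closed_Collect_all closed_Collect_eq cont continuous_on_const)
  then have M: "complete M"
    by (simp add: complete_eq_closed)
  have pow_Suc: "(R ^^ Suc k) x = (R ^^ k) (R x)" for k x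
    by (simp add: funpow_swap1)
  have RM: "R x \<in> M" if "x \<in> M" for x
    using that unfolding M_def by (simp add: pow_Suc[symmetric] del: funpow.simps)
  have RbM: "R b \<in> M"
    using zero unfolding M_def by (simp add: pow_Suc[symmetric] del: funpow.simps)
  have MM: "x - a *\<^sub>C y \<in> M" if "x \<in> M" "y \<in> M" for x y a
    using that unfolding M_def by (simp add: pow cinner_diff_left cinner_scaleC_left)
  \<comment> \<open>The radius \<open>1 / L\<close> makes the Lipschitz constant
    \<open>cmod h * L\<close> smaller than 1.\<close>
  have "t \<in> invariant_zeros D A b c" if "t \<in> ball s (1 / L)" for t
  proof -
    define h where "h = t - s"
    have h: "cmod h * L < 1"
      using that L(1) by (simp add: h_def dist_norm norm_minus_commute field_simps)
    have "\<exists>!x\<in>M. R b - h *\<^sub>C R x = x"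
    proof (rule Banach_fix)
      show "(\<lambda>x. R b - h *\<^sub>C R x) ` M \<subseteq> M"
        using RM RbM MM by auto
      fix x y assume "x \<in> M" "y \<in> M"
      have "dist (R b - h *\<^sub>C R x) (R b - h *\<^sub>C R y) = norm (h *\<^sub>C R (y - x))"
        by (simp add: dist_norm lin complex_vector.scale_right_diff_distrib)
      also have "\<dots> \<le> cmod h * (norm (y - x) * L)"
        unfolding norm_scaleC by (intro mult_left_mono L(2)) simp
      finally show "dist (R b - h *\<^sub>C R x) (R b - h *\<^sub>C R y) \<le> (cmod h * L) * dist x y"
        by (simp add: dist_norm norm_minus_commute mult_ac)
    qed (use M RbM h L(1) in auto)
    then obtain x where xM: "x \<in> M" and x: "R b - h *\<^sub>C R x = x"
      by blast
    \<comment> \<open>The fixed point lies in the range of \<open>R\<close>, hence in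
      \<open>D\<close>, and solves \<open>t *\<^sub>C x - A x = b\<close>: it witnesses the zero
      \<open>t\<close> with input \<open>u = 1\<close>.\<close>
    have xR: "x = R (b - h *\<^sub>C x)"
      using x by (simp add: lin)
    have "x \<in> D" "s *\<^sub>C x - A x = b - h *\<^sub>C x"
      using R(2)[of "b - h *\<^sub>C x"] unfolding xR[symmetric] by auto
    moreover from this have "t *\<^sub>C x - A x = b"
      by (simp add: h_def complex_vector.scale_left_diff_distrib algebra_simps)
    moreover have "x \<noteq> 0"
    proof
      assume "x = 0"
      then have "R b = 0"
        using x lin(3)[of 0 0] by simp
      then show False
        using R(2)[of b] R(2)[of 0] lin(3)[of 0 0] b by auto
    qed
    moreover have "cinner x c = 0"
      using xM unfolding M_def by (metis (mono_tags) funpow_0 mem_Collect_eq)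
    ultimately show ?thesis
      unfolding invariant_zeros_def by (auto intro!: bexI[of _ x] exI[of _ 1])
  qed
  with L(1) show thesis
    by (intro that[of "1 / L"]) auto
qed

section \<open>Eigenfunctions and the final estimate\<close>

text \<open>\<open>A_inf\<close> differs from \<open>A\<close> by a multiple of \<open>b\<close>, to
  which \<open>R\<close> is applied. Any two eigenvectors for the same zero are therefore
  proportional, which links \<open>z n\<close> to the Riesz system.\<close>

lemma eigenvector_A_inf_eq_resolvent:
  assumes R: "bounded_clinear R" "\<forall>x\<in>D. R (s *\<^sub>C x - A x) = x"
    and x: "eigenvector D (A_inf A b c) s x"
  obtains a where "a \<noteq> 0" "x = a *\<^sub>C R b"
proof -
  define a where "a = - (cinner (A x) c / cinner b c)"
  have "s *\<^sub>C x - A x = a *\<^sub>C b"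
    using x by (auto simp: eigenvector_def A_inf_def a_def algebra_simps)
  then have "x = a *\<^sub>C R b"
    using R x unfolding eigenvector_def bounded_clinear_def by metis
  moreover have "x \<noteq> 0"
    using x by (simp add: eigenvector_def)
  ultimately show thesis
    by (intro that[of a]) auto
qed

theorem theorem2p15:
  fixes D :: "'a::complex_hilbert_space set" and A :: "'a \<Rightarrow> 'a" and b c :: 'a
    and J :: "nat set" and \<mu> :: "nat \<Rightarrow> complex"
    and z :: "nat \<Rightarrow> 'a" and \<phi> :: "complex \<Rightarrow> 'a" and \<epsilon> :: real
  assumes "siso_system D A b c"
    and "minimal_system D A b c"
    and "cinner b c \<noteq> 0"
    and "c \<in> adjoint_domain D A"
    and "\<And>s. s \<in> invariant_zeros D A b c \<Longrightarrow> eigenvector D (A_inf A b c) s (\<phi> s)"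
    and "riesz_system (invariant_zeros D A b c) \<phi>"
    and "lists_invariant_zeros D A b c J \<mu>"
    and "\<And>n. n \<in> J \<Longrightarrow> eigenvector D (A_inf A b c) (\<mu> n) (z n) \<and> norm (z n) = 1"
    and "\<epsilon> > 0"
  shows "\<exists>N. \<forall>n\<in>J. n > N \<longrightarrow>
           norm (A (z n) - \<mu> n *\<^sub>C z n) < \<epsilon> \<and> \<mu> n \<in> pseudospectrum D A \<epsilon>"
proof -
  let ?Z = "invariant_zeros D A b c"
  have b: "b \<noteq> 0"
    using assms(1) by (simp add: siso_system_def)
  have range: "\<mu> ` J = ?Z"
    and mult: "\<And>s. s \<in> ?Z \<Longrightarrow> ecard {n \<in> J. \<mu> n = s} = zero_multiplicity D A b c s"
    using assms(7) by (auto simp: lists_invariant_zeros_def)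
  have "countable ?Z"
    unfolding range[symmetric] by simp
  have resolvent: "\<exists>R. bounded_clinear R \<and> (\<forall>y. R y \<in> D \<and> s *\<^sub>C R y - A (R y) = y) \<and>
      (\<forall>x\<in>D. R (s *\<^sub>C x - A x) = x)" if "s \<in> ?Z" for s
    using assms(2) that by (auto simp: minimal_system_def spectrum_def resolvent_set_def)
  have finite_mult: "finite {n \<in> J. \<mu> n = s}" if s: "s \<in> ?Z" for s
  proof -
    obtain R where R: "bounded_clinear R" "\<And>y. R y \<in> D \<and> s *\<^sub>C R y - A (R y) = y"
      "\<forall>x\<in>D. R (s *\<^sub>C x - A x) = x"
      using resolvent[OF s] by blast
    have "\<exists>k. cinner ((R ^^ Suc k) b) c \<noteq> 0"
    proof (rule ccontr)
      assume "\<not> ?thesis"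
      then obtain r where "r > 0" "ball s r \<subseteq> ?Z"
        using ball_subset_invariant_zeros[OF R(1,2) b] by blast
      then show False
        using \<open>countable ?Z\<close> uncountable_ball countable_subset by blast
    qed
    then have "zero_multiplicity D A b c s < \<infinity>"
      unfolding zero_multiplicity_def by (rule algebraic_multiplicity_A_inf_finite[OF R(1,3)])
    then show ?thesis
      using mult[OF s] by (auto simp: ecard_def split: if_splits)
  qed
  \<comment> \<open>\<open>w\<close> is \<open>A* c\<close>; it turns \<open>cinner (A x) c\<close>
    into a bounded functional of \<open>x\<close>.\<close>
  obtain w where w: "\<And>x. x \<in> D \<Longrightarrow> cinner (A x) c = cinner x w"
    using assms(4) by (auto simp: adjoint_domain_def)
  obtain L where L: "L > 0" "\<And>s. s \<in> ?Z \<Longrightarrow> 1 \<le> L * norm (\<phi> s)"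
    using riesz_system_norm_bound[OF assms(6)] by blast
  \<comment> \<open>Chosen so that \<open>L * \<delta> * norm b / cmod (cinner b c)\<close> equals
    \<open>\<epsilon>\<close>, the bound reached at the end of the estimate.\<close>
  define \<delta> where "\<delta> = \<epsilon> * cmod (cinner b c) / (L * norm b)"
  have "\<delta> > 0"
    using assms(3,9) b L(1) by (simp add: \<delta>_def)
  have small: "norm (A (z n) - \<mu> n *\<^sub>C z n) < \<epsilon> \<and> \<mu> n \<in> pseudospectrum D A \<epsilon>"
    if n: "n \<in> J" and lt: "cmod (cinner (\<phi> (\<mu> n)) w) < \<delta>" for n
  proof -
    have Z: "\<mu> n \<in> ?Z"
      using range n by blast
    have zn: "eigenvector D (A_inf A b c) (\<mu> n) (z n)" "norm (z n) = 1"
      using assms(8)[OF n] by auto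
    then have zD: "z n \<in> D"
      by (simp add: eigenvector_def)
    obtain R where R: "bounded_clinear R" "\<forall>x\<in>D. R (\<mu> n *\<^sub>C x - A x) = x"
      using resolvent[OF Z] by blast
    obtain a where a: "z n = a *\<^sub>C R b"
      using eigenvector_A_inf_eq_resolvent[OF R zn(1)] by blast
    obtain a' where a': "a' \<noteq> 0" "\<phi> (\<mu> n) = a' *\<^sub>C R b"
      using eigenvector_A_inf_eq_resolvent[OF R assms(5)[OF Z]] by blast
    define p where "p = a / a'"
    have p: "z n = p *\<^sub>C \<phi> (\<mu> n)"
      using a a' by (simp add: p_def scaleC_scaleC)
    \<comment> \<open>The normalization of \<open>z n\<close> and the lower bound on
      \<open>norm (\<phi> (\<mu> n))\<close> control \<open>p\<close> uniformly in
      \<open>n\<close>.\<close>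
    have "1 = cmod p * norm (\<phi> (\<mu> n))"
      using zn(2) unfolding p norm_scaleC by simp
    then have "cmod p \<le> cmod p * (L * norm (\<phi> (\<mu> n)))"
      using mult_left_mono[OF L(2)[OF Z], of "cmod p"] by simp
    also have "\<dots> = L * (cmod p * norm (\<phi> (\<mu> n)))"
      by (simp add: mult_ac)
    finally have pL: "cmod p \<le> L"
      using \<open>1 = cmod p * norm (\<phi> (\<mu> n))\<close> by simp
    have "A (z n) - \<mu> n *\<^sub>C z n = (cinner (z n) w / cinner b c) *\<^sub>C b"
      using zn(1) w[OF zD] by (simp add: eigenvector_def A_inf_def algebra_simps)
    then have "norm (A (z n) - \<mu> n *\<^sub>C z n)
        = cmod p * cmod (cinner (\<phi> (\<mu> n)) w) * norm b / cmod (cinner b c)"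
      by (simp add: norm_scaleC p cinner_scaleC_left norm_mult norm_divide)
    also have "\<dots> \<le> L * cmod (cinner (\<phi> (\<mu> n)) w) * norm b / cmod (cinner b c)"
      using pL by (intro divide_right_mono mult_right_mono) auto
    also have "\<dots> < \<epsilon>"
      using lt L(1) b assms(3) by (simp add: \<delta>_def field_simps)
    finally have "norm (A (z n) - \<mu> n *\<^sub>C z n) < \<epsilon>" .
    then show ?thesis
      using zD zn(2) by (auto simp: pseudospectrum_def norm_minus_commute)
  qed
  \<comment> \<open>The exceptional zeros: finitely many, each listed finitely often, so their
    indices have a common bound \<open>N\<close>.\<close>
  define F where "F = {s \<in> ?Z. cmod (cinner (\<phi> s) w) \<ge> \<delta>}"
  have "finite F"
    unfolding F_def by (rule riesz_system_finite_large_coefficients[OF assms(6) \<open>\<delta> > 0\<close>])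
  then have "finite (\<Union>s\<in>F. {n \<in> J. \<mu> n = s})"
    using finite_mult by (intro finite_UN_I) (auto simp: F_def)
  then obtain N where N: "\<forall>n\<in>\<Union>s\<in>F. {n \<in> J. \<mu> n = s}. n \<le> N"
    unfolding finite_nat_set_iff_bounded_le ..
  have "norm (A (z n) - \<mu> n *\<^sub>C z n) < \<epsilon> \<and> \<mu> n \<in> pseudospectrum D A \<epsilon>"
    if "n \<in> J" "n > N" for n
  proof (rule small[OF \<open>n \<in> J\<close>])
    have "\<mu> n \<notin> F"
      using N that by fastforce
    then show "cmod (cinner (\<phi> (\<mu> n)) w) < \<delta>"
      using range \<open>n \<in> J\<close> by (auto simp: F_def not_le)
  qed
  then show ?thesis
    by blast
qed

end
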